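(* If a d.c.e. real in $(0,1)$ is neither left-c.e. nor right-c.e., then it is fully d.c.e. speedable.
   Context: Conventions: "real" means a real number in the open interval $(0,1)$. An approximation of a real $\alpha$ is a sequence $\{a_s\}_{s\in\omega}$ of rational numbers in $[0,1]$ converging to $\alpha$. It is computable if $a_s$ can be computed from $s$. A computable approximation is left-c.e. if it is nondecreasing, right-c.e. if it is nonincreasing, and d.c.e. if it has bounded variation, i.e. $\sum_{s}|a_s-a_{s+1}|<\infty$. A real is left-c.e. (right-c.e., d.c.e.) if it has a left-c.e. (right-c.e., d.c.e.) approximation. A computable order is a computable function $f:\mathbb N\to\mathbb N$ that is nondecreasing and unbounded. Let $\{a_s\}_{s\in\omega}$ be a computable approximation of $\alpha$ and let $\rho\in[0,1)$ be rational. The approximation is $\rho$-speedable if either $\alpha$ is rational, or $\alpha$ is irrational and there is a computable order $f$ with $$\liminf_{s\to\infty}\left|\frac{\alpha-a_{f(s)}}{\alpha-a_s}\right|\le\rho .$$ It is speedable if it is $\rho$-speedable for some $\rho\in[0,1)$. A real is fully d.c.e. speedable if it is d.c.e. and all of its d.c.e. approximations are speedable. *)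

theory Defs
  imports Complex_Main "HOL-Library.Extended_Real" "HOL-Library.Liminf_Limsup"
begin

text \<open>Programs for the partial recursive functions and their big-step evaluation relation.
  Arities are not recorded in the syntax: a program is applied to an argument list, and it has
  no value on lists that are too short for it.\<close>

datatype recf =
    Zero
  | Succ
  | Proj nat
  | Comp recf "recf list"
  | PrimRec recf recf
  | Mu recf

inductive evaluates :: "recf \<Rightarrow> nat list \<Rightarrow> nat \<Rightarrow> bool" where
  Zero: "evaluates Zero xs 0"
| Succ: "evaluates Succ (x # xs) (Suc x)"
| Proj: "i < length xs \<Longrightarrow> evaluates (Proj i) xs (xs ! i)"
| Comp: "\<lbrakk>list_all2 (\<lambda>g y. evaluates g xs y) gs ys; evaluates f ys z\<rbrakk>
    \<Longrightarrow> evaluates (Comp f gs) xs z"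
| PrimRec_0: "evaluates f xs y \<Longrightarrow> evaluates (PrimRec f g) (0 # xs) y"
| PrimRec_Suc: "\<lbrakk>evaluates (PrimRec f g) (n # xs) y; evaluates g (n # y # xs) z\<rbrakk>
    \<Longrightarrow> evaluates (PrimRec f g) (Suc n # xs) z"
| Mu: "\<lbrakk>evaluates f (n # xs) 0; \<And>m. m < n \<Longrightarrow> \<exists>y. evaluates f (m # xs) (Suc y)\<rbrakk>
    \<Longrightarrow> evaluates (Mu f) xs n"

lemma evaluates_deterministic:
  "evaluates r xs y \<Longrightarrow> evaluates r xs z \<Longrightarrow> y = z"
proof (induction r xs y arbitrary: z rule: evaluates.induct)
  case (Zero xs)
  then show ?case by (auto elim: evaluates.cases)
next
  case (Succ x xs)
  then show ?case by (auto elim: evaluates.cases)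
next
  case (Proj i xs)
  from Proj(2) show ?case by (auto elim: evaluates.cases)
next
  case (Comp xs gs ys f y)
  from Comp.prems obtain ys' where
    ys': "list_all2 (\<lambda>g y. evaluates g xs y) gs ys'" and z: "evaluates f ys' z"
    by (auto elim: evaluates.cases)
  have "ys = ys'"
    using Comp.IH(1) ys' by (auto simp: list_all2_conv_all_nth intro!: nth_equalityI)
  then show ?case using Comp.IH(2) z by blast
next
  case (PrimRec_0 f xs y g)
  from PrimRec_0.prems have "evaluates f xs z" by (auto elim: evaluates.cases)
  then show ?case using PrimRec_0.IH by blast
next
  case (PrimRec_Suc f g n xs y w)
  from PrimRec_Suc.prems obtain y' where
    "evaluates (PrimRec f g) (n # xs) y'" "evaluates g (n # y' # xs) z"
    by (auto elim: evaluates.cases)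
  then show ?case using PrimRec_Suc.IH by blast
next
  case (Mu f n xs)
  from Mu.prems have z0: "evaluates f (z # xs) 0"
    and below: "\<And>m. m < z \<Longrightarrow> \<exists>y. evaluates f (m # xs) (Suc y)"
    by (auto elim: evaluates.cases)
  have "\<not> z < n" using Mu.IH(2) z0 by fastforce
  moreover have "\<not> n < z" using Mu.IH(1) below by fastforce
  ultimately show ?case by simp
qed

definition computable :: "(nat \<Rightarrow> nat) \<Rightarrow> bool" where
  "computable f \<longleftrightarrow> (\<exists>r. \<forall>x. evaluates r [x] (f x))"

text \<open>A computable sequence of nonnegative rationals is one for which a numerator and a nonzero
  denominator (not necessarily in lowest terms) can be computed from the index. All
  approximations considered below have values in $[0,1]$, so no sign is needed.\<close>

definition computable_nonneg_rat_seq :: "(nat \<Rightarrow> rat) \<Rightarrow> bool" where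
  "computable_nonneg_rat_seq a \<longleftrightarrow>
     (\<exists>p q. computable p \<and> computable q \<and>
        (\<forall>s. q s \<noteq> 0 \<and> a s = of_nat (p s) / of_nat (q s)))"

definition approximation :: "real \<Rightarrow> (nat \<Rightarrow> rat) \<Rightarrow> bool" where
  "approximation \<alpha> a \<longleftrightarrow>
     (\<forall>s. 0 \<le> a s \<and> a s \<le> 1) \<and> (\<lambda>s. real_of_rat (a s)) \<longlonglongrightarrow> \<alpha>"

definition computable_approximation :: "real \<Rightarrow> (nat \<Rightarrow> rat) \<Rightarrow> bool" where
  "computable_approximation \<alpha> a \<longleftrightarrow> approximation \<alpha> a \<and> computable_nonneg_rat_seq a"

definition left_ce_approximation :: "real \<Rightarrow> (nat \<Rightarrow> rat) \<Rightarrow> bool" where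
  "left_ce_approximation \<alpha> a \<longleftrightarrow> computable_approximation \<alpha> a \<and> incseq a"

definition right_ce_approximation :: "real \<Rightarrow> (nat \<Rightarrow> rat) \<Rightarrow> bool" where
  "right_ce_approximation \<alpha> a \<longleftrightarrow> computable_approximation \<alpha> a \<and> decseq a"

definition dce_approximation :: "real \<Rightarrow> (nat \<Rightarrow> rat) \<Rightarrow> bool" where
  "dce_approximation \<alpha> a \<longleftrightarrow>
     computable_approximation \<alpha> a \<and> summable (\<lambda>s. real_of_rat \<bar>a s - a (Suc s)\<bar>)"

definition left_ce :: "real \<Rightarrow> bool" where
  "left_ce \<alpha> \<longleftrightarrow> (\<exists>a. left_ce_approximation \<alpha> a)"

definition right_ce :: "real \<Rightarrow> bool" where
  "right_ce \<alpha> \<longleftrightarrow> (\<exists>a. right_ce_approximation \<alpha> a)"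

definition dce :: "real \<Rightarrow> bool" where
  "dce \<alpha> \<longleftrightarrow> (\<exists>a. dce_approximation \<alpha> a)"

definition computable_order :: "(nat \<Rightarrow> nat) \<Rightarrow> bool" where
  "computable_order f \<longleftrightarrow> computable f \<and> mono f \<and> (\<forall>n. \<exists>s. n \<le> f s)"

text \<open>The quotients need not be bounded, so the limit inferior is taken in the extended reals.
  Since \<open>a\<close> is rational-valued, the denominators are nonzero for irrational \<open>\<alpha>\<close>.\<close>

definition rho_speedable :: "rat \<Rightarrow> real \<Rightarrow> (nat \<Rightarrow> rat) \<Rightarrow> bool" where
  "rho_speedable \<rho> \<alpha> a \<longleftrightarrow>
     \<alpha> \<in> \<rat> \<or>
     (\<alpha> \<notin> \<rat> \<and>
      (\<exists>f. computable_order f \<and>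
        liminf (\<lambda>s. ereal \<bar>(\<alpha> - real_of_rat (a (f s))) / (\<alpha> - real_of_rat (a s))\<bar>)
          \<le> ereal (real_of_rat \<rho>)))"

definition speedable :: "real \<Rightarrow> (nat \<Rightarrow> rat) \<Rightarrow> bool" where
  "speedable \<alpha> a \<longleftrightarrow> (\<exists>\<rho>. 0 \<le> \<rho> \<and> \<rho> < 1 \<and> rho_speedable \<rho> \<alpha> a)"

definition fully_dce_speedable :: "real \<Rightarrow> bool" where
  "fully_dce_speedable \<alpha> \<longleftrightarrow>
     dce \<alpha> \<and> (\<forall>a. dce_approximation \<alpha> a \<longrightarrow> speedable \<alpha> a)"

end

theory Submission imports Defs begin

text \<open>
  Let \<open>a\<close> be a computable approximation that is not speedable and put \<open>e = a - \<alpha>\<close>. Then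
  \<open>\<bar>e (h s)\<bar> > 9/10 * \<bar>e s\<bar>\<close> holds eventually for every computable order \<open>h\<close>. For \<open>h = Suc\<close> this says
  that \<open>\<alpha>\<close> lies outside the interval of points that are closer to \<open>a (Suc u)\<close> than to \<open>a u\<close> by the
  factor 9/10. As \<open>\<alpha>\<close> is neither left-c.e. nor right-c.e., \<open>a\<close> crosses \<open>\<alpha>\<close> infinitely often, and each
  crossing of size \<open>J\<close> leaves behind an interval of size about \<open>9 * J\<close> next to \<open>\<alpha>\<close>, on the side where
  it landed. Waiting until \<open>a\<close> leaves the intervals that contain its present value is a computable
  order \<open>f\<close>. After a crossing of maximal size, \<open>f\<close> can neither make progress
  inside this interval nor leave \<open>a\<close> beyond it, so its next value is a crossing of comparable
  size in the other direction. Now there are large intervals on both sides of \<open>\<alpha>\<close>; waiting for \<open>a\<close> to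
  leave all intervals at once (a second order \<open>g\<close>) forces progress towards \<open>\<alpha>\<close>.
\<close>

section \<open>Closure properties of the computable functions\<close>

text \<open>Programs carry no arity, so it is fixed here as the length of the argument list; on
  other lists \<open>F\<close> is unconstrained.\<close>

definition computable_on :: "nat \<Rightarrow> (nat list \<Rightarrow> nat) \<Rightarrow> bool" where
  "computable_on n F \<longleftrightarrow> (\<exists>r. \<forall>xs. length xs = n \<longrightarrow> evaluates r xs (F xs))"

lemma computable_on_cong:
  assumes "computable_on n F" "\<And>xs. length xs = n \<Longrightarrow> F xs = G xs"
  shows "computable_on n G"
  using assms unfolding computable_on_def by metis

lemma computable_on_nth: "i < n \<Longrightarrow> computable_on n (\<lambda>xs. xs ! i)"
  unfolding computable_on_def by (auto intro!: exI[of _ "Proj i"] evaluates.Proj)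

lemma computable_on_compose:
  assumes F: "computable_on (length Gs) F" and Gs: "\<And>G. G \<in> set Gs \<Longrightarrow> computable_on n G"
  shows "computable_on n (\<lambda>xs. F (map (\<lambda>G. G xs) Gs))"
proof -
  obtain r where r: "\<forall>ys. length ys = length Gs \<longrightarrow> evaluates r ys (F ys)"
    using F unfolding computable_on_def by blast
  have "\<exists>q. \<forall>G\<in>set Gs. \<forall>xs. length xs = n \<longrightarrow> evaluates (q G) xs (G xs)"
    using Gs unfolding computable_on_def by metis
  then obtain q where q: "\<And>G xs. G \<in> set Gs \<Longrightarrow> length xs = n \<Longrightarrow> evaluates (q G) xs (G xs)"
    by blast
  have "evaluates (Comp r (map q Gs)) xs (F (map (\<lambda>G. G xs) Gs))" if "length xs = n" for xs
    by (rule evaluates.Comp[of _ _ "map (\<lambda>G. G xs) Gs"])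
      (auto simp: list_all2_conv_all_nth q that intro!: r[rule_format])
  then show ?thesis unfolding computable_on_def by blast
qed

lemma computable_on_compose1:
  assumes "computable_on 1 (\<lambda>xs. h (xs ! 0))" "computable_on n F"
  shows "computable_on n (\<lambda>xs. h (F xs))"
  using computable_on_compose[of "[F]" "\<lambda>xs. h (xs ! 0)" n] assms by simp

lemma computable_on_compose2:
  assumes "computable_on 2 (\<lambda>xs. h (xs ! 0) (xs ! 1))" "computable_on n F" "computable_on n G"
  shows "computable_on n (\<lambda>xs. h (F xs) (G xs))"
  using computable_on_compose[of "[F, G]" "\<lambda>xs. h (xs ! 0) (xs ! 1)" n] assms
  by (auto simp: numeral_2_eq_2)

lemma computable_on_Cons:
  assumes "computable_on (Suc n) H" "computable_on n F"
  shows "computable_on n (\<lambda>xs. H (F xs # xs))"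
proof -
  have "computable_on n (\<lambda>xs. H (map (\<lambda>G. G xs) (F # map (\<lambda>i xs. xs ! i) [0..<n])))"
    using assms by (intro computable_on_compose) (auto intro: computable_on_nth)
  then show ?thesis
    by (rule computable_on_cong) (auto simp: comp_def intro!: arg_cong[of _ _ H] nth_equalityI)
qed

lemma computable_on_tl:
  assumes "computable_on n F"
  shows "computable_on (Suc n) (\<lambda>xs. F (tl xs))"
proof -
  have "computable_on (Suc n) (\<lambda>xs. F (map (\<lambda>G. G xs) (map (\<lambda>i xs. xs ! Suc i) [0..<n])))"
    using assms by (intro computable_on_compose) (auto intro: computable_on_nth)
  then show ?thesis
    by (rule computable_on_cong) (auto simp: comp_def nth_tl intro!: arg_cong[of _ _ F] nth_equalityI)
qed

lemma computable_on_nth_tl: "Suc i < n \<Longrightarrow> computable_on n (\<lambda>xs. tl xs ! i)"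
  by (rule computable_on_cong[OF computable_on_nth[of "Suc i"]]) (auto simp: nth_tl)

lemma computable_on_Suc:
  assumes "computable_on n F"
  shows "computable_on n (\<lambda>xs. Suc (F xs))"
proof (rule computable_on_compose1[OF _ assms])
  show "computable_on 1 (\<lambda>xs. Suc (xs ! 0))"
    unfolding computable_on_def
    by (auto intro!: exI[of _ Succ] simp: length_Suc_conv intro: evaluates.Succ)
qed

lemma computable_on_const: "computable_on n (\<lambda>xs. c)"
proof (induction c)
  case 0
  then show ?case unfolding computable_on_def by (auto intro!: exI[of _ Zero] evaluates.Zero)
qed (rule computable_on_Suc)

text \<open>The recursion is first built with its counter as an extra head argument, as
  \<open>PrimRec\<close> expects; \<open>N\<close> is then substituted for it by
  \<open>computable_on_Cons\<close>.\<close>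

lemma computable_on_rec:
  assumes A: "computable_on n A" and S: "computable_on (Suc (Suc n)) (\<lambda>xs. S (xs ! 0) (xs ! 1) (tl (tl xs)))"
    and N: "computable_on n N"
  shows "computable_on n (\<lambda>xs. rec_nat (A xs) (\<lambda>k y. S k y xs) (N xs))"
proof -
  obtain a where a: "\<forall>xs. length xs = n \<longrightarrow> evaluates a xs (A xs)"
    using A unfolding computable_on_def by blast
  obtain s where s: "\<forall>xs. length xs = Suc (Suc n) \<longrightarrow>
      evaluates s xs (S (xs ! 0) (xs ! 1) (tl (tl xs)))"
    using S unfolding computable_on_def by blast
  have "evaluates (PrimRec a s) (k # xs) (rec_nat (A xs) (\<lambda>k y. S k y xs) k)"
    if "length xs = n" for k xs
  proof (induction k)
    case 0
    then show ?case using a that by (auto intro: evaluates.PrimRec_0)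
  next
    case (Suc k)
    then show ?case using s[rule_format, of "k # _ # xs"] that by (auto intro!: evaluates.PrimRec_Suc)
  qed
  then have "computable_on (Suc n) (\<lambda>xs. rec_nat (A (tl xs)) (\<lambda>k y. S k y (tl xs)) (hd xs))"
    unfolding computable_on_def by (auto intro!: exI[of _ "PrimRec a s"] simp: length_Suc_conv)
  from computable_on_Cons[OF this N] show ?thesis by simp
qed

lemma computable_on_add:
  assumes "computable_on n F" "computable_on n G"
  shows "computable_on n (\<lambda>xs. F xs + G xs)"
proof -
  have "computable_on n (\<lambda>xs. rec_nat (F xs) (\<lambda>k y. Suc y) (G xs))"
    by (intro computable_on_rec assms computable_on_Suc computable_on_nth) simp
  moreover have "rec_nat x (\<lambda>k y. Suc y) m = x + m" for x m by (induction m) auto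
  ultimately show ?thesis by simp
qed

lemma computable_on_mult:
  assumes "computable_on n F" "computable_on n G"
  shows "computable_on n (\<lambda>xs. F xs * G xs)"
proof -
  have "computable_on n (\<lambda>xs. rec_nat 0 (\<lambda>k y. y + F xs) (G xs))"
    by (intro computable_on_rec assms computable_on_const computable_on_add computable_on_nth
      computable_on_tl) simp
  moreover have "rec_nat 0 (\<lambda>k y. y + x) m = x * m" for x m :: nat by (induction m) auto
  ultimately show ?thesis by simp
qed

lemma computable_on_diff:
  assumes "computable_on n F" "computable_on n G"
  shows "computable_on n (\<lambda>xs. F xs - G xs)"
proof -
  have pred: "computable_on m (\<lambda>xs. H xs - 1)" if "computable_on m H" for m H
  proof -
    have "computable_on m (\<lambda>xs. rec_nat 0 (\<lambda>k y. k) (H xs))"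
      by (intro computable_on_rec that computable_on_const computable_on_nth) simp
    moreover have "rec_nat 0 (\<lambda>k y. k) x = x - 1" for x :: nat by (cases x) auto
    ultimately show ?thesis by simp
  qed
  have "computable_on n (\<lambda>xs. rec_nat (F xs) (\<lambda>k y. y - 1) (G xs))"
    by (intro computable_on_rec assms pred computable_on_nth) simp
  moreover have "rec_nat x (\<lambda>k y. y - 1) m = x - m" for x m :: nat by (induction m) auto
  ultimately show ?thesis by simp
qed

section \<open>Decidable predicates, bounded quantifiers and least witnesses\<close>

definition decidable_on :: "nat \<Rightarrow> (nat list \<Rightarrow> bool) \<Rightarrow> bool" where
  "decidable_on n P \<longleftrightarrow> computable_on n (\<lambda>xs. of_bool (P xs))"

lemma decidable_on_less:
  assumes "computable_on n F" "computable_on n G"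
  shows "decidable_on n (\<lambda>xs. F xs < G xs)"
proof -
  \<comment> \<open>Truncated subtraction makes \<open>1 - (1 - x)\<close> equal to 1 for
    \<open>x > 0\<close> and to 0 for \<open>x = 0\<close>.\<close>
  have "computable_on n (\<lambda>xs. 1 - (1 - (G xs - F xs)))"
    by (intro assms computable_on_diff computable_on_const)
  then show ?thesis unfolding decidable_on_def by (rule computable_on_cong) auto
qed

lemma decidable_on_not:
  assumes "decidable_on n P"
  shows "decidable_on n (\<lambda>xs. \<not> P xs)"
proof -
  have "computable_on n (\<lambda>xs. 1 - of_bool (P xs))"
    using assms unfolding decidable_on_def by (intro computable_on_diff computable_on_const)
  then show ?thesis unfolding decidable_on_def by (rule computable_on_cong) auto
qed

lemma decidable_on_conj:
  assumes "decidable_on n P" "decidable_on n Q"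
  shows "decidable_on n (\<lambda>xs. P xs \<and> Q xs)"
  using computable_on_mult[OF assms[unfolded decidable_on_def]]
  unfolding decidable_on_def by (rule computable_on_cong) auto

lemma computable_on_if:
  assumes "decidable_on n P" "computable_on n F" "computable_on n G"
  shows "computable_on n (\<lambda>xs. if P xs then F xs else G xs)"
proof -
  have "computable_on n (\<lambda>xs. of_bool (P xs) * F xs + of_bool (\<not> P xs) * G xs)"
    using assms decidable_on_not[OF assms(1)] unfolding decidable_on_def
    by (intro computable_on_add computable_on_mult) auto
  then show ?thesis by (rule computable_on_cong) auto
qed

lemma decidable_on_bex_less:
  assumes P: "decidable_on (Suc n) (\<lambda>xs. P (xs ! 0) (tl xs))" and N: "computable_on n N"
  shows "decidable_on n (\<lambda>xs. \<exists>u<N xs. P u xs)"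
proof -
  \<comment> \<open>The accumulator is a flag: a witness sets it to 1, and it is kept from then
    on.\<close>
  define S :: "nat \<Rightarrow> nat \<Rightarrow> nat list \<Rightarrow> nat"
    where "S k y xs = (if P k xs then 1 else y)" for k y xs
  have "computable_on (Suc (Suc n)) (\<lambda>xs. of_bool (P (xs ! 0) (tl (tl xs))))"
  proof -
    have tl2: "map (\<lambda>i. xs ! Suc (Suc i)) [0..<n] = tl (tl xs)"
      if "length xs = Suc (Suc n)" for xs :: "nat list"
      using that by (intro nth_equalityI) (auto simp: nth_tl)
    \<comment> \<open>\<open>P\<close> does not see the accumulator, so the projections skip
      position 1.\<close>
    have "computable_on (Suc (Suc n))
      (\<lambda>xs. of_bool (P (map (\<lambda>G. G xs) ((\<lambda>xs. xs ! 0) # map (\<lambda>i xs. xs ! Suc (Suc i)) [0..<n]) ! 0)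
        (tl (map (\<lambda>G. G xs) ((\<lambda>xs. xs ! 0) # map (\<lambda>i xs. xs ! Suc (Suc i)) [0..<n])))))"
      using P unfolding decidable_on_def
      by (intro computable_on_compose[where F = "\<lambda>xs. of_bool (P (xs ! 0) (tl xs))"])
        (auto intro: computable_on_nth)
    then show ?thesis
      by (rule computable_on_cong)
        (simp add: comp_def tl2)
  qed
  then have "computable_on n (\<lambda>xs. rec_nat 0 (\<lambda>k y. S k y xs) (N xs))"
    unfolding S_def
    by (intro computable_on_rec N computable_on_const computable_on_if computable_on_nth)
      (auto simp: decidable_on_def)
  moreover have "rec_nat 0 (\<lambda>k y. S k y xs) m = of_bool (\<exists>u<m. P u xs)" for xs m
    by (induction m) (auto simp: S_def less_Suc_eq)
  ultimately show ?thesis by (simp add: decidable_on_def)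
qed

text \<open>\<open>Mu\<close> searches for a zero, so it is run on the characteristic function of
  the negation; \<open>ex\<close> makes the search end.\<close>

lemma computable_on_Least:
  assumes P: "decidable_on (Suc n) (\<lambda>xs. P (xs ! 0) (tl xs))"
    and ex: "\<And>xs. length xs = n \<Longrightarrow> \<exists>k. P k xs"
  shows "computable_on n (\<lambda>xs. LEAST k. P k xs)"
proof -
  obtain r where r: "\<forall>xs. length xs = Suc n \<longrightarrow> evaluates r xs (of_bool (\<not> P (xs ! 0) (tl xs)))"
    using decidable_on_not[OF P, unfolded decidable_on_def] unfolding computable_on_def by blast
  have "evaluates (Mu r) xs (LEAST k. P k xs)" if len: "length xs = n" for xs
  proof (rule evaluates.Mu)
    have "P (LEAST k. P k xs) xs" using ex[OF len] by (rule LeastI_ex)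
    then show "evaluates r ((LEAST k. P k xs) # xs) 0"
      using r[rule_format, of "(LEAST k. P k xs) # xs"] len by simp
    show "\<exists>y. evaluates r (m # xs) (Suc y)" if "m < (LEAST k. P k xs)" for m
      using r[rule_format, of "m # xs"] len not_less_Least[OF that] by (auto intro!: exI[of _ 0])
  qed
  then show ?thesis unfolding computable_on_def by blast
qed

lemma computable_iff_computable_on: "computable h \<longleftrightarrow> computable_on 1 (\<lambda>xs. h (xs ! 0))"
proof -
  have "(\<forall>x. evaluates r [x] (h x)) \<longleftrightarrow> (\<forall>xs. length xs = 1 \<longrightarrow> evaluates r xs (h (xs ! 0)))" for r
  proof (intro iffI allI impI)
    fix xs :: "nat list"
    assume r: "\<forall>x. evaluates r [x] (h x)" and "length xs = 1"
    then obtain x where "xs = [x]" by (auto simp: length_Suc_conv)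
    then show "evaluates r xs (h (xs ! 0))" using r by simp
  next
    fix x
    assume "\<forall>xs. length xs = 1 \<longrightarrow> evaluates r xs (h (xs ! 0))"
    from this[rule_format, of "[x]"] show "evaluates r [x] (h x)" by simp
  qed
  then show ?thesis unfolding computable_def computable_on_def by simp
qed

lemma computable_compose:
  "computable h \<Longrightarrow> computable_on n F \<Longrightarrow> computable_on n (\<lambda>xs. h (F xs))"
  unfolding computable_iff_computable_on by (rule computable_on_compose1)

section \<open>Sequences that make no progress towards their limit\<close>

definition progress :: "(nat \<Rightarrow> real) \<Rightarrow> nat \<Rightarrow> nat \<Rightarrow> bool" where
  "progress e u i \<longleftrightarrow> 10 * \<bar>e i - e (Suc u)\<bar> < 9 * \<bar>e i - e u\<bar>"

lemma progress_uminus [simp]: "progress (\<lambda>s. - e s) u i \<longleftrightarrow> progress e u i"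
  unfolding progress_def by (simp only: minus_diff_minus abs_minus_cancel)

text \<open>By \<open>slow\<close> the point 0 violates the inequality, so the interval lies
  entirely on the side of 0 that contains \<open>e (Suc u)\<close>.\<close>

lemma progress_sign:
  fixes e :: "nat \<Rightarrow> real"
  assumes slow: "\<bar>e (Suc u)\<bar> > 9/10 * \<bar>e u\<bar>" and i: "progress e u i"
  shows "e i > 0 \<longleftrightarrow> e (Suc u) > 0"
proof -
  have "\<bar>e i - e u\<bar> \<le> \<bar>e i\<bar> + \<bar>e u\<bar>" by simp
  then have "10 * \<bar>e i - e (Suc u)\<bar> < 9 * \<bar>e i\<bar> + 10 * \<bar>e (Suc u)\<bar>"
    using slow i unfolding progress_def by linarith
  then show ?thesis by (auto simp: abs_if split: if_splits)
qed

text \<open>The order \<open>f\<close> is invoked only at stages in \<open>B\<close>, where it leaves every interval containing the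
  present value, whereas \<open>g\<close> leaves all intervals recorded so far, on both sides of 0.\<close>

locale slow =
  fixes e :: "nat \<Rightarrow> real" and s0 :: nat and B :: "nat set" and f g :: "nat \<Rightarrow> nat"
  assumes lim: "e \<longlonglongrightarrow> 0"
    and nonzero: "e s \<noteq> 0"
    and changes: "\<exists>k\<ge>n. e k * e (Suc k) < 0"
    and slow_Suc: "s \<ge> s0 \<Longrightarrow> \<bar>e (Suc s)\<bar> > 9/10 * \<bar>e s\<bar>"
    and slow_f: "s \<ge> s0 \<Longrightarrow> \<bar>e (f s)\<bar> > 9/10 * \<bar>e s\<bar>"
    and slow_g: "s \<ge> s0 \<Longrightarrow> \<bar>e (g s)\<bar> > 9/10 * \<bar>e s\<bar>"
    and change_B: "s \<ge> s0 \<Longrightarrow> e s * e (Suc s) < 0 \<Longrightarrow> Suc s \<in> B"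
    and f_B: "s < f s" "f s \<in> B"
    and f_sign: "s \<ge> s0 \<Longrightarrow> s \<le> t \<Longrightarrow> t < f s \<Longrightarrow> e t > 0 \<longleftrightarrow> e s > 0"
    and f_leaves: "s \<in> B \<Longrightarrow> s0 \<le> u \<Longrightarrow> u < s \<Longrightarrow> progress e u s \<Longrightarrow> \<not> progress e u (f s)"
    and g_B: "s < g s" "g s \<in> B"
    and g_leaves: "s0 \<le> u \<Longrightarrow> u < s \<Longrightarrow> \<not> progress e u (g s)"
begin

text \<open>By \<open>f_sign\<close> the sign is constant before stage \<open>f s\<close>, so it
  changes in the very last step.\<close>

lemma change_at_f:
  assumes "s \<ge> s0" "e s > 0" "e (f s) < 0"
  obtains j where "f s = Suc j" "s \<le> j" "e j > 0"
proof -
  obtain j where j: "f s = Suc j" using f_B(1)[of s] by (cases "f s") auto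
  then have "s \<le> j" using f_B(1)[of s] by simp
  then show ?thesis using that j f_sign[of s j] assms by simp
qed

text \<open>Take the last stage \<open>l\<close> in \<open>B\<close> after \<open>k\<close> with
  value at least \<open>M\<close>. Crossings are too small to produce the values at
  \<open>f l\<close> and \<open>f (f l)\<close>, so both are positive and in the band, although
  \<open>f\<close> has to leave the interval of \<open>k\<close>.\<close>

lemma barriers_below:
  assumes k: "k \<ge> s0" and M: "0 < M"
    and band: "\<And>i. 81/100 * M < e i \<Longrightarrow> e i < M \<Longrightarrow> progress e k i"
    and small: "\<And>j. j \<ge> k \<Longrightarrow> e j * e (Suc j) < 0 \<Longrightarrow> \<bar>e (Suc j) - e j\<bar> < 81/100 * M"
    and w: "w \<in> B" "w > k"
  shows "e w < M"
proof (rule ccontr)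
  assume "\<not> e w < M"
  define W where "W = {t \<in> B. t > k \<and> e t \<ge> M}"
  have "eventually (\<lambda>t. e t < M) sequentially"
    using lim M by (rule order_tendstoD)
  then obtain N where N: "\<And>t. t \<ge> N \<Longrightarrow> e t < M" by (auto simp: eventually_sequentially)
  have "W \<subseteq> {..N}"
  proof
    show "t \<in> {..N}" if "t \<in> W" for t using that N[of t] by (cases "t \<le> N") (auto simp: W_def)
  qed
  then have fin: "finite W" by (rule finite_subset) simp
  have "w \<in> W" using w \<open>\<not> e w < M\<close> by (simp add: W_def)
  define l where "l = Max W"
  have lW: "l \<in> W" unfolding l_def using fin \<open>w \<in> W\<close> by (intro Max_in) auto
  have last: "e t < M" if "t \<in> B" "t > l" for t
  proof (rule ccontr)
    assume "\<not> e t < M"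
    then have "t \<in> W" using that lW by (auto simp: W_def)
    then show False using Max_ge[OF fin, of t] that by (simp add: l_def)
  qed
  \<comment> \<open>A crossing from a positive \<open>e j\<close> to \<open>e (f s)\<close> is
    larger than \<open>\<bar>e (f s)\<bar>\<close>, against \<open>small\<close>.\<close>
  have no_change: "e (f s) > 0" if s: "s > k" "e s > 0" "\<bar>e (f s)\<bar> > 81/100 * M" for s
  proof (rule ccontr)
    assume "\<not> e (f s) > 0"
    then have neg: "e (f s) < 0" using nonzero[of "f s"] by simp
    obtain j where "f s = Suc j" "s \<le> j" "e j > 0"
      by (rule change_at_f[OF _ s(2) neg]) (use s(1) k in simp)
    note j = this
    then have "\<bar>e (Suc j) - e j\<bar> < 81/100 * M"
      using small[of j] neg s(1) by (simp add: mult_pos_neg)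
    then show False using j(1,3) neg s(3) by simp
  qed
  \<comment> \<open>Two uses of \<open>slow_f\<close> lose a factor 9/10 each, which explains the
    constant 81/100.\<close>
  define v where "v = f l"
  have l: "l \<in> B" "l > k" "e l \<ge> M" using lW by (auto simp: W_def)
  have v_slow: "\<bar>e v\<bar> > 9/10 * \<bar>e l\<bar>" unfolding v_def using slow_f l k by simp
  have v: "v \<in> B" "v > l" using f_B[of l] by (auto simp: v_def)
  have "e v > 0" using no_change[of l] v_slow l M by (simp add: v_def)
  then have v_in: "9/10 * M < e v" "e v < M" using v_slow l last[of v] v M by auto
  then have pv: "progress e k v" using band[of v] M by simp
  have fv_slow: "\<bar>e (f v)\<bar> > 81/100 * M" using slow_f[of v] v l k v_in by auto
  then have "e (f v) > 0" using no_change[of v] v l v_in M by simp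
  then have "progress e k (f v)"
    using band[of "f v"] fv_slow last[of "f v"] f_B[of v] v by auto
  then show False using f_leaves[of v k] pv v l k by simp
qed

end

section \<open>A crossing of maximal size and the contradiction it yields\<close>

lemma max_change:
  fixes e :: "nat \<Rightarrow> real"
  assumes lim: "e \<longlonglongrightarrow> 0" and changes: "\<And>n. \<exists>k\<ge>n. e k * e (Suc k) < 0"
  obtains k where "k \<ge> n" "e k * e (Suc k) < 0"
    "\<And>j. j \<ge> n \<Longrightarrow> e j * e (Suc j) < 0 \<Longrightarrow> \<bar>e (Suc j) - e j\<bar> \<le> \<bar>e (Suc k) - e k\<bar>"
proof -
  define d where "d j = \<bar>e (Suc j) - e j\<bar>" for j
  obtain i where i: "i \<ge> n" "e i * e (Suc i) < 0" using changes by blast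
  have "d i > 0" using i(2) by (auto simp: d_def mult_less_0_iff)
  \<comment> \<open>Step sizes tend to 0, so only finitely many stages compete with the crossing at
    \<open>i\<close>.\<close>
  have "d \<longlonglongrightarrow> \<bar>0 - 0\<bar>" unfolding d_def
    by (intro tendsto_intros LIMSEQ_Suc lim)
  then have "eventually (\<lambda>j. d j < d i) sequentially" using \<open>d i > 0\<close> by (intro order_tendstoD(2)) auto
  then obtain N where N: "\<And>j. j \<ge> N \<Longrightarrow> d j < d i" by (auto simp: eventually_sequentially)
  define S where "S = {j. n \<le> j \<and> j < N \<and> e j * e (Suc j) < 0}"
  have "i < N" using N[of i] by (meson not_le order_less_irrefl)
  then have "i \<in> S" "finite S" using i by (auto simp: S_def)
  then have "Max (d ` S) \<in> d ` S" by (intro Max_in) auto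
  then obtain k where k: "k \<in> S" "d k = Max (d ` S)" by auto
  have mx: "d j \<le> d k" if "j \<in> S" for j using that k \<open>finite S\<close> by simp
  show ?thesis
  proof (rule that[of k])
    show "\<bar>e (Suc j) - e j\<bar> \<le> \<bar>e (Suc k) - e k\<bar>" if "j \<ge> n" "e j * e (Suc j) < 0" for j
    proof (cases "j < N")
      case True then show ?thesis using mx[of j] that by (auto simp: S_def d_def)
    next
      case False then show ?thesis using N[of j] mx[OF \<open>i \<in> S\<close>] by (auto simp: d_def)
    qed
  qed (use k in \<open>auto simp: S_def\<close>)
qed

text \<open>Reflection at 0 carries statements about one side over to the other;
  \<open>f_sign\<close> survives it because no value is 0.\<close>

lemma (in slow) slow_uminus: "slow (\<lambda>s. - e s) s0 B f g"
proof
  show "(\<lambda>s. - e s) \<longlonglongrightarrow> 0" using tendsto_minus[OF lim] by simp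
next
  fix s t assume a: "s \<ge> s0" "s \<le> t" "t < f s"
  show "(- e t > 0) \<longleftrightarrow> (- e s > 0)"
    using f_sign[OF a] nonzero[of t] nonzero[of s] by auto
qed (use nonzero changes slow_Suc slow_f slow_g change_B f_B f_leaves g_B g_leaves in simp_all)

lemma (in slow) no_upward_max_change:
  assumes k: "k \<ge> s0" "e k < 0" "e (Suc k) > 0"
    and mx: "\<And>j. j \<ge> k \<Longrightarrow> e j * e (Suc j) < 0 \<Longrightarrow> \<bar>e (Suc j) - e j\<bar> \<le> \<bar>e (Suc k) - e k\<bar>"
  shows False
proof -
  interpret neg: slow "\<lambda>s. - e s" s0 B f g by (rule slow_uminus)
  \<comment> \<open>Crossings have size at most \<open>M / 2\<close>, hence less than
    \<open>81/100 * M\<close>, while the intervals used below still reach as far as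
    \<open>M\<close>.\<close>
  define M where "M = 2 * (e (Suc k) - e k)"
  define r where "r = f (Suc k)"
  have M: "0 < M" using k by (simp add: M_def)
  have y: "e (Suc k) > - (9/10) * e k" using slow_Suc[of k] k by simp
  \<comment> \<open>With \<open>x = - e k\<close> and \<open>y = e (Suc k)\<close> the interval runs
    from \<open>(10 * y - 9 * x) / 19\<close> to \<open>10 * y + 9 * x\<close>; the lower end is
    below \<open>10/19 * y\<close>, and \<open>10/19 < 53/100\<close>.\<close>
  have hole: "progress e k i" if "53/100 * e (Suc k) < e i" "e i < M" for i
  proof -
    have "\<bar>e i - e k\<bar> = e i - e k" using that k by simp
    then show ?thesis using that y k unfolding progress_def M_def by (simp add: abs_if)
  qed
  have small: "\<bar>e (Suc j) - e j\<bar> < 81/100 * M" if "j \<ge> k" "e j * e (Suc j) < 0" for j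
    using mx[OF that] M by (simp add: M_def)
  have below: "e w < M" if "w \<in> B" "w > k" for w
    using k(1) M _ small that
    by (rule barriers_below) (use hole k in \<open>auto simp: M_def\<close>)
  have kB: "Suc k \<in> B" using change_B k by (simp add: mult_neg_pos)
  have r: "r \<in> B" "r > Suc k" using f_B[of "Suc k"] by (auto simp: r_def)
  have r_slow: "\<bar>e r\<bar> > 9/10 * e (Suc k)" unfolding r_def using slow_f[of "Suc k"] k by simp
  have "progress e k (Suc k)" using hole[of "Suc k"] k by (simp add: M_def)
  then have out: "\<not> progress e k r" unfolding r_def using f_leaves kB k by simp
  \<comment> \<open>A positive \<open>e r\<close> would lie between \<open>9/10 * e (Suc k)\<close>
    and \<open>M\<close>, thus in the interval of \<open>k\<close>, which \<open>r\<close> has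
    left.\<close>
  have "e r < 0"
  proof (rule ccontr)
    assume "\<not> e r < 0"
    then show False using hole[of r] out below[of r] r r_slow k by auto
  qed
  then obtain j where j: "r = Suc j" "Suc k \<le> j" "e j > 0"
    using change_at_f[of "Suc k"] k by (auto simp: r_def)
  have z: "- e (Suc j) > 9/10 * e j" "- e (Suc j) > 9/10 * e (Suc k)"
    using slow_Suc[of j] j r_slow \<open>e r < 0\<close> k by auto
  have J: "e j - e (Suc j) \<le> M / 2"
    using mx[of j] j \<open>e r < 0\<close> k by (auto simp: M_def mult_pos_neg)
  \<comment> \<open>The mirror image: with \<open>z = - e (Suc j)\<close> the far end is at distance
    \<open>10 * z + 9 * e j > 9 * e (Suc k)\<close> from 0, and \<open>M < 38/9 * e (Suc k)\<close>
    by \<open>y\<close>.\<close>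
  have hole': "progress e j i" if "53/100 * - e (Suc j) < - e i" "- e i < M" for i
    
  proof -
    have "\<bar>e i - e j\<bar> = e j - e i" using that z j k by simp
    then show ?thesis using that z J y k j unfolding progress_def M_def by (simp add: abs_if)
  qed
  have below': "- e w < M" if "w \<in> B" "w > j" for w
  proof (rule neg.barriers_below[of j M])
    show "progress (\<lambda>s. - e s) j i" if "81/100 * M < - e i" "- e i < M" for i
      using hole'[of i] J M that j by simp
    show "\<bar>- e (Suc i) - - e i\<bar> < 81/100 * M" if "j \<le> i" "- e i * - e (Suc i) < 0" for i
      using small[of i] that j by (simp add: abs_minus_commute)
  qed (use that M j k in auto)
  \<comment> \<open>Here \<open>\<bar>e v\<bar>\<close> exceeds both \<open>9/10 * - e r\<close> and
    \<open>81/100 * e (Suc k)\<close>, and it stays below \<open>M\<close>. So \<open>v\<close> is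
    in the interval of \<open>k\<close> or of \<open>j\<close>, but \<open>g\<close> leaves
    both.\<close>
  define v where "v = g r"
  have v: "v \<in> B" "v > r" using g_B[of r] by (auto simp: v_def)
  have v_slow: "\<bar>e v\<bar> > 9/10 * - e r" unfolding v_def using slow_g[of r] k r \<open>e r < 0\<close> by simp
  have "\<not> progress e k v" "\<not> progress e j v"
    unfolding v_def using g_leaves k r j by auto
  then show False
    using hole[of v] hole'[of v] below[of v] below'[of v] v r j v_slow z k by (cases "e v > 0") auto
qed

text \<open>A largest crossing after \<open>s0\<close> goes upwards either for \<open>e\<close> or
  for \<open>- e\<close>.\<close>

lemma (in slow) impossible: False
proof -
  interpret neg: slow "\<lambda>s. - e s" s0 B f g by (rule slow_uminus)
  obtain k where k: "k \<ge> s0" "e k * e (Suc k) < 0"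
    "\<And>j. j \<ge> s0 \<Longrightarrow> e j * e (Suc j) < 0 \<Longrightarrow> \<bar>e (Suc j) - e j\<bar> \<le> \<bar>e (Suc k) - e k\<bar>"
    using max_change[OF lim changes] by blast
  show False
  proof (cases "e k < 0")
    case True
    show False
    proof (rule no_upward_max_change)
      show "e k < 0" "e (Suc k) > 0" using True k(2) by (auto simp: mult_less_0_iff)
    qed (use k(1,3) in auto)
  next
    case False
    show False
    proof (rule neg.no_upward_max_change)
      show "- e k < 0" "- e (Suc k) > 0" using False k(2) by (auto simp: mult_less_0_iff)
      show "\<bar>- e (Suc j) - - e j\<bar> \<le> \<bar>- e (Suc k) - - e k\<bar>"
        if "j \<ge> k" "- e j * - e (Suc j) < 0" for j
        using k(3)[of j] that k(1) by (simp add: abs_minus_commute)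
    qed (use k(1) in auto)
  qed
qed

section \<open>Barriers\<close>

text \<open>\<open>slow\<close> is the strict opposite inequality at the limit value 0, so it
  persists for values close to the limit.\<close>

lemma eventually_not_progress:
  assumes lim: "e \<longlonglongrightarrow> 0" and slow: "\<bar>e (Suc u)\<bar> > 9/10 * \<bar>e u\<bar>"
  shows "eventually (\<lambda>t. \<not> progress e u t) sequentially"
proof -
  have "(\<lambda>t. 10 * \<bar>e t - e (Suc u)\<bar> - 9 * \<bar>e t - e u\<bar>) \<longlonglongrightarrow> 10 * \<bar>0 - e (Suc u)\<bar> - 9 * \<bar>0 - e u\<bar>"
    by (intro tendsto_intros lim)
  then have "eventually (\<lambda>t. 10 * \<bar>e t - e (Suc u)\<bar> - 9 * \<bar>e t - e u\<bar> > 0) sequentially"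
    by (rule order_tendstoD) (use slow in simp)
  then show ?thesis by eventually_elim (simp add: progress_def)
qed

text \<open>A barrier is a stage \<open>t\<close> with \<open>last_barrier e n t = t\<close>. Only intervals recorded before the last
  barrier and containing the value at that barrier can delay the next one; they all avoid the
  limit 0 of \<open>e\<close>, so every sign change is a barrier.\<close>

primrec last_barrier :: "(nat \<Rightarrow> real) \<Rightarrow> nat \<Rightarrow> nat \<Rightarrow> nat" where
  "last_barrier e n 0 = 0"
| "last_barrier e n (Suc t) =
    (if \<exists>u<last_barrier e n t. n \<le> u \<and> progress e u (last_barrier e n t) \<and> progress e u (Suc t)
     then last_barrier e n t else Suc t)"

lemma last_barrier_le: "last_barrier e n t \<le> t"
  by (induction t) auto

text \<open>If \<open>Suc t\<close> is no barrier, its value shares an interval with the value at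
  the last barrier, and \<open>progress_sign\<close> applies to both.\<close>

lemma last_barrier_sign:
  assumes "\<And>s. s \<ge> n \<Longrightarrow> \<bar>e (Suc s)\<bar> > 9/10 * \<bar>e s\<bar>"
  shows "e t > 0 \<longleftrightarrow> e (last_barrier e n t) > 0"
proof (induction t)
  case (Suc t)
  then show ?case using progress_sign[of e, OF assms] by auto
qed simp

definition next_barrier :: "(nat \<Rightarrow> real) \<Rightarrow> nat \<Rightarrow> nat \<Rightarrow> nat" where
  "next_barrier e n s = (LEAST t. s < t \<and> last_barrier e n t = t)"

text \<open>Only intervals recorded before \<open>s\<close> count: if
  \<open>e t \<noteq> e (t - 1)\<close>, the interval of \<open>t - 1\<close> contains
  \<open>e t\<close>, so a search avoiding all \<open>u < t\<close> could fail.\<close>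

definition next_outer_barrier :: "(nat \<Rightarrow> real) \<Rightarrow> nat \<Rightarrow> nat \<Rightarrow> nat" where
  "next_outer_barrier e n s =
    (LEAST t. s < t \<and> last_barrier e n t = t \<and> \<not> (\<exists>u<s. n \<le> u \<and> progress e u t))"

text \<open>A larger \<open>s\<close> admits fewer \<open>t\<close>, so the least one cannot
  decrease.\<close>

lemma mono_Least:
  assumes "\<And>s. \<exists>t. P s t" "\<And>s s' t. s \<le> s' \<Longrightarrow> P s' t \<Longrightarrow> P s t"
  shows "mono (\<lambda>s::nat. LEAST t::nat. P s t)"
  by (intro monoI Least_le) (use assms LeastI_ex in blast)

locale crossing =
  fixes e :: "nat \<Rightarrow> real" and n :: nat
  assumes lim: "e \<longlonglongrightarrow> 0"
    and nonzero: "e s \<noteq> 0"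
    and changes: "\<exists>k\<ge>m. e k * e (Suc k) < 0"
    and slow: "s \<ge> n \<Longrightarrow> \<bar>e (Suc s)\<bar> > 9/10 * \<bar>e s\<bar>"
begin

abbreviation "b \<equiv> last_barrier e n"
abbreviation "f \<equiv> next_barrier e n"
abbreviation "g \<equiv> next_outer_barrier e n"

lemma change_barrier:
  assumes "e k * e (Suc k) < 0"
  shows "b (Suc k) = Suc k"
proof (rule ccontr)
  assume "b (Suc k) \<noteq> Suc k"
  then have "b (Suc k) = b k" by (auto split: if_splits)
  then have "e (Suc k) > 0 \<longleftrightarrow> e k > 0"
    using last_barrier_sign[of n e k] last_barrier_sign[of n e "Suc k"] slow by metis
  then show False using assms by (auto simp: mult_less_0_iff)
qed

lemma ex_barrier: "\<exists>t>s. b t = t"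
  using changes[of s] change_barrier by (meson le_imp_less_Suc)

lemma ex_outer_barrier: "\<exists>t>s. b t = t \<and> \<not> (\<exists>u<s. n \<le> u \<and> progress e u t)"
proof -
  \<comment> \<open>Finitely many intervals are all left for good at some stage, and barriers occur
    beyond every stage.\<close>
  have "eventually (\<lambda>t. \<forall>u\<in>{n..<s}. \<not> progress e u t) sequentially"
    by (intro eventually_ball_finite ballI eventually_not_progress lim slow) auto
  then obtain N where N: "\<forall>t\<ge>N. \<forall>u\<in>{n..<s}. \<not> progress e u t"
    unfolding eventually_sequentially by blast
  obtain t where "t > max N s" "b t = t" using ex_barrier by blast
  then show ?thesis using N by (intro exI[of _ t]) auto
qed

lemma f: "s < f s" "b (f s) = f s"
  using LeastI_ex[OF ex_barrier[of s]] by (simp_all add: next_barrier_def)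

lemma g: "s < g s" "b (g s) = g s" "\<not> (\<exists>u<s. n \<le> u \<and> progress e u (g s))"
  using LeastI_ex[OF ex_outer_barrier[of s]] unfolding next_outer_barrier_def by blast+

lemma last_barrier_before_f:
  assumes "s \<le> t" "t < f s"
  shows "b t = b s"
  using assms
proof (induction t rule: dec_induct)
  case (step t)
  have "b (Suc t) \<noteq> Suc t"
    using not_less_Least[of "Suc t" "\<lambda>t. s < t \<and> b t = t"] step by (simp add: next_barrier_def)
  then have "b (Suc t) = b t" by (auto split: if_splits)
  then show ?case using step by simp
qed simp

lemma f_sign:
  assumes "s \<le> t" "t < f s"
  shows "e t > 0 \<longleftrightarrow> e s > 0"
  using last_barrier_before_f[OF assms] last_barrier_sign[of n e] slow by metis

lemma f_leaves:
  assumes "b s = s" "n \<le> u" "u < s" "progress e u s"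
  shows "\<not> progress e u (f s)"
proof
  assume "progress e u (f s)"
  obtain j where j: "f s = Suc j" using f(1)[of s] by (cases "f s") auto
  \<comment> \<open>Just before \<open>f s\<close> the last barrier is still \<open>s\<close>; an
    interval common to \<open>s\<close> and \<open>f s\<close> would keep it there.\<close>
  then have "b j = s" using last_barrier_before_f[of s j] f(1)[of s] assms(1) by simp
  then have "b (Suc j) = s" using assms \<open>progress e u (f s)\<close> j by auto
  then show False using f[of s] j by simp
qed

lemma mono_f: "mono f"
  unfolding next_barrier_def[abs_def] using ex_barrier by (intro mono_Least) auto

lemma mono_g: "mono g"
  unfolding next_outer_barrier_def[abs_def] using ex_outer_barrier
  by (intro mono_Least) (auto intro: less_le_trans)

lemma not_eventually_slow:
  assumes "eventually (\<lambda>s. \<bar>e (f s)\<bar> > 9/10 * \<bar>e s\<bar>) sequentially"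
    and "eventually (\<lambda>s. \<bar>e (g s)\<bar> > 9/10 * \<bar>e s\<bar>) sequentially"
  shows False
proof -
  obtain m where m: "\<And>s. s \<ge> m \<Longrightarrow> \<bar>e (f s)\<bar> > 9/10 * \<bar>e s\<bar> \<and> \<bar>e (g s)\<bar> > 9/10 * \<bar>e s\<bar>"
    using eventually_conj[OF assms] by (auto simp: eventually_sequentially)
  \<comment> \<open>\<open>B\<close> becomes the set of barriers; from \<open>max n m\<close> on the
    bounds for \<open>Suc\<close>, \<open>f\<close> and \<open>g\<close> hold together.\<close>
  interpret slow e "max n m" "{t. b t = t}" f g
    by unfold_locales
      (use lim nonzero changes slow m change_barrier f g f_sign f_leaves in auto)
  show False by (rule impossible)
qed

end

section \<open>Computability of the barriers and of the two orders\<close>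

lemma decidable_on_progress:
  assumes p: "computable p" and q: "computable q" and "\<And>s. q s \<noteq> 0"
    and e: "\<And>s. e s = real (p s) / real (q s) - \<alpha>"
    and U: "computable_on n U" and I: "computable_on n I"
  shows "decidable_on n (\<lambda>xs. progress e (U xs) (I xs))"
proof -
  \<comment> \<open>Distance of natural numbers by truncated subtraction. The real
    \<open>\<alpha>\<close> cancels in differences of \<open>e\<close>, so numerators and
    denominators suffice.\<close>
  define d :: "nat \<Rightarrow> nat \<Rightarrow> nat" where "d x y = (x - y) + (y - x)" for x y
  have d: "\<bar>e i - e j\<bar> = d (p i * q j) (p j * q i) / (real (q i) * real (q j))" for i j
  proof -
    have "real (d x y) = \<bar>real x - real y\<bar>" for x y by (auto simp: d_def)
    moreover have "e i - e j = (real (p i * q j) - real (p j * q i)) / (real (q i) * real (q j))"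
      using assms(3) by (simp add: e field_simps)
    ultimately show ?thesis by (simp add: abs_divide abs_mult)
  qed
  \<comment> \<open>Denominators are cleared; the factor \<open>1 / q i\<close> is common to both
    sides.\<close>
  have "progress e u i \<longleftrightarrow>
    10 * d (p i * q (Suc u)) (p (Suc u) * q i) * q u < 9 * d (p i * q u) (p u * q i) * q (Suc u)"
    (is "_ \<longleftrightarrow> 10 * ?x * _ < 9 * ?y * _") for u i
  proof -
    have pos: "real (q s) > 0" for s using assms(3)[of s] by simp
    have "progress e u i \<longleftrightarrow> 10 * real ?x * real (q u) < 9 * real ?y * real (q (Suc u))"
      unfolding progress_def d using pos[of i] pos[of u] pos[of "Suc u"]
      by (simp add: field_simps)
    also have "\<dots> \<longleftrightarrow> real (10 * ?x * q u) < real (9 * ?y * q (Suc u))" by simp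
    finally show ?thesis by (simp only: of_nat_less_iff)
  qed
  moreover have "decidable_on n (\<lambda>xs.
    10 * d (p (I xs) * q (Suc (U xs))) (p (Suc (U xs)) * q (I xs)) * q (U xs)
      < 9 * d (p (I xs) * q (U xs)) (p (U xs) * q (I xs)) * q (Suc (U xs)))"
    unfolding d_def
    by (intro decidable_on_less computable_on_mult computable_on_const computable_on_add
      computable_on_diff computable_compose[OF p] computable_compose[OF q] computable_on_Suc U I)
  ultimately show ?thesis by simp
qed

lemma computable_last_barrier:
  assumes progress: "\<And>k U I. computable_on k U \<Longrightarrow> computable_on k I
    \<Longrightarrow> decidable_on k (\<lambda>xs. progress e (U xs) (I xs))"
  shows "computable (last_barrier e n)"
proof -
  define P where "P u t y \<longleftrightarrow> \<not> u < n \<and> progress e u y \<and> progress e u (Suc t)" for u t y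
  define h where "h t y = (if \<exists>u<y. P u t y then y else Suc t)" for t y
  have "decidable_on (Suc 2) (\<lambda>xs. P (xs ! 0) (tl xs ! 0) (tl xs ! 1))"
    unfolding P_def
    by (intro decidable_on_conj decidable_on_not decidable_on_less progress computable_on_Suc
      computable_on_nth computable_on_nth_tl computable_on_const) simp_all
  then have "decidable_on 2 (\<lambda>xs. \<exists>u<xs ! 1. P u (xs ! 0) (xs ! 1))"
    by (rule decidable_on_bex_less[where P = "\<lambda>u xs. P u (xs ! 0) (xs ! 1)"])
      (simp add: computable_on_nth)
  then have "computable_on 2 (\<lambda>xs. h (xs ! 0) (xs ! 1))"
    unfolding h_def by (intro computable_on_if computable_on_Suc computable_on_nth) simp_all
  then have "computable_on (Suc (Suc 1)) (\<lambda>xs. h (xs ! 0) (xs ! 1))"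
    by (rule computable_on_compose2[of h]) (simp_all add: computable_on_nth)
  then have "computable_on 1 (\<lambda>xs. rec_nat 0 h (xs ! 0))"
    by (intro computable_on_rec[where S = "\<lambda>k y xs. h k y"] computable_on_const computable_on_nth) simp_all
  moreover have "rec_nat 0 h t = last_barrier e n t" for t
    by (induction t) (simp_all add: h_def P_def not_less)
  ultimately show ?thesis by (simp add: computable_iff_computable_on)
qed

text \<open>By \<open>last_barrier_le\<close> the second conjunct says that \<open>T xs\<close> is a
  barrier, so deciding \<open><\<close> is enough.\<close>

lemma decidable_on_barrier:
  assumes "computable (last_barrier e n)" "computable_on k S" "computable_on k T"
  shows "decidable_on k (\<lambda>xs. S xs < T xs \<and> \<not> last_barrier e n (T xs) < T xs)"
  using assms
  by (intro decidable_on_conj decidable_on_not decidable_on_less computable_compose[OF assms(1)])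

context crossing
begin

lemma computable_order_f:
  assumes b: "computable b"
  shows "computable_order f"
proof -
  have "decidable_on (Suc 1) (\<lambda>xs. tl xs ! 0 < xs ! 0 \<and> \<not> b (xs ! 0) < xs ! 0)"
    by (intro decidable_on_barrier b computable_on_nth computable_on_nth_tl) simp_all
  moreover have "\<not> b t < t \<longleftrightarrow> b t = t" for t using last_barrier_le[of e n t] by auto
  ultimately have "computable_on 1 (\<lambda>xs. LEAST t. xs ! 0 < t \<and> b t = t)"
    using ex_barrier
    by (intro computable_on_Least[where P = "\<lambda>t xs. xs ! 0 < t \<and> b t = t"]) auto
  then have "computable f" by (simp add: computable_iff_computable_on next_barrier_def)
  then show ?thesis
    unfolding computable_order_def using mono_f less_imp_le[OF f(1)] by blast
qed

lemma computable_order_g: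
  assumes b: "computable b"
    and progress: "\<And>k U I. computable_on k U \<Longrightarrow> computable_on k I
      \<Longrightarrow> decidable_on k (\<lambda>xs. progress e (U xs) (I xs))"
  shows "computable_order g"
proof -
  define P where "P t s \<longleftrightarrow> (s < t \<and> \<not> b t < t) \<and> \<not> (\<exists>u<s. \<not> u < n \<and> progress e u t)" for t s
  have "decidable_on (Suc 2) (\<lambda>xs. \<not> xs ! 0 < n \<and> progress e (xs ! 0) (tl xs ! 0))"
    by (intro decidable_on_conj decidable_on_not decidable_on_less progress
      computable_on_nth computable_on_const computable_on_nth_tl) simp_all
  then have "decidable_on 2 (\<lambda>xs. \<exists>u<xs ! 1. \<not> u < n \<and> progress e u (xs ! 0))"
    by (rule decidable_on_bex_less[where P = "\<lambda>u xs. \<not> u < n \<and> progress e u (xs ! 0)"])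
      (simp add: computable_on_nth)
  then have "decidable_on 2 (\<lambda>xs. P (xs ! 0) (xs ! 1))"
    unfolding P_def
    by (intro decidable_on_conj decidable_on_barrier b decidable_on_not computable_on_nth) simp_all
  then have "decidable_on (Suc 1) (\<lambda>xs. P (xs ! 0) (tl xs ! 0))"
    unfolding decidable_on_def
    by (rule computable_on_compose2[of "\<lambda>t s. of_bool (P t s)"])
      (simp_all add: computable_on_nth computable_on_nth_tl)
  moreover have P: "P t s \<longleftrightarrow> s < t \<and> b t = t \<and> \<not> (\<exists>u<s. n \<le> u \<and> progress e u t)" for t s
    using last_barrier_le[of e n t] by (auto simp: P_def not_less)
  ultimately have "computable_on 1 (\<lambda>xs. LEAST t. P t (xs ! 0))"
    using ex_outer_barrier
    by (intro computable_on_Least[where P = "\<lambda>t xs. P t (xs ! 0)"]) (simp_all only: P)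
  then have "computable g"
    by (simp add: computable_iff_computable_on next_outer_barrier_def P)
  then show ?thesis
    unfolding computable_order_def using mono_g less_imp_le[OF g(1)] by blast
qed

end

section \<open>Approximations that cross their limit\<close>

text \<open>With a strict comparison of sequence terms as \<open>R\<close>, \<open>m k\<close> is an
  index of the running maximum or minimum over stages \<open>N\<close> to \<open>N + k\<close>;
  tracking indices keeps the recursion within the natural numbers.\<close>

lemma computable_running_index:
  assumes "decidable_on 2 (\<lambda>xs. R (xs ! 0) (xs ! 1))"
  shows "\<exists>m. computable m \<and> m 0 = N
    \<and> (\<forall>k. m (Suc k) = (if R (m k) (N + Suc k) then N + Suc k else m k))"
proof -
  let ?h = "\<lambda>k y. if R y (N + Suc k) then N + Suc k else y"
  define m where "m = rec_nat N ?h"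
  have R: "decidable_on k (\<lambda>xs. R (F xs) (G xs))" if "computable_on k F" "computable_on k G" for k F G
    using computable_on_compose2[of "\<lambda>x y. of_bool (R x y)", OF _ that] assms
    by (simp add: decidable_on_def)
  have "computable_on 1 (\<lambda>xs. rec_nat N ?h (xs ! 0))"
    by (intro computable_on_rec computable_on_const computable_on_if R computable_on_nth
      computable_on_add computable_on_Suc) auto
  then have "computable m" by (simp add: computable_iff_computable_on m_def)
  then show ?thesis by (intro exI[of _ m]) (simp add: m_def)
qed

lemma decidable_on_rat_less:
  assumes "computable p" "computable q" "\<And>s. q s \<noteq> 0 \<and> a s = of_nat (p s) / of_nat (q s)"
    and "computable_on n F" "computable_on n G"
  shows "decidable_on n (\<lambda>xs. a (F xs) < (a (G xs) :: rat))"
proof -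
  have "a i < a j \<longleftrightarrow> p i * q j < p j * q i" for i j
  proof -
    have "a i < a j \<longleftrightarrow> (of_nat (p i * q j) :: rat) < of_nat (p j * q i)"
    proof -
      have "(0::rat) < of_nat (q i)" "(0::rat) < of_nat (q j)"
        using conjunct1[OF assms(3), of i] conjunct1[OF assms(3), of j] by simp_all
      then have "(of_nat (p i) / of_nat (q i) < (of_nat (p j) / of_nat (q j) :: rat)) \<longleftrightarrow>
          of_nat (p i) * of_nat (q j) < (of_nat (p j) * of_nat (q i) :: rat)"
        by (simp add: field_simps)
      then show ?thesis by (simp only: conjunct2[OF assms(3)] of_nat_mult)
    qed
    then show ?thesis by (simp only: of_nat_less_iff)
  qed
  moreover have "decidable_on n (\<lambda>xs. p (F xs) * q (G xs) < p (G xs) * q (F xs))"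
    by (intro decidable_on_less computable_on_mult computable_compose[OF assms(1)]
      computable_compose[OF assms(2)] assms(4,5))
  ultimately show ?thesis by simp
qed

lemma computable_approximation_subseq:
  assumes "computable_approximation \<alpha> a" "computable m"
    and "(\<lambda>s. real_of_rat (a (m s))) \<longlonglongrightarrow> \<alpha>"
  shows "computable_approximation \<alpha> (\<lambda>s. a (m s))"
proof -
  obtain p q where "computable p" "computable q" "\<forall>s. q s \<noteq> 0 \<and> a s = of_nat (p s) / of_nat (q s)"
    using assms unfolding computable_approximation_def computable_nonneg_rat_seq_def by blast
  moreover have "computable (\<lambda>s. h (m s))" if "computable h" for h
    using computable_compose[OF that, of 1 "\<lambda>xs. m (xs ! 0)"] assms(2)
    by (simp add: computable_iff_computable_on)
  ultimately have "computable_nonneg_rat_seq (\<lambda>s. a (m s))"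
    unfolding computable_nonneg_rat_seq_def
    by (intro exI[of _ "\<lambda>s. p (m s)"] exI[of _ "\<lambda>s. q (m s)"]) simp
  then show ?thesis using assms by (simp add: computable_approximation_def approximation_def)
qed

text \<open>The running maximum from \<open>N\<close> on is nondecreasing and squeezed between the
  approximation and \<open>\<alpha>\<close>.\<close>

lemma left_ce_if_eventually_le:
  assumes a: "computable_approximation \<alpha> a"
    and le: "eventually (\<lambda>s. real_of_rat (a s) \<le> \<alpha>) sequentially"
  shows "left_ce \<alpha>"
proof -
  obtain N where N: "\<And>s. s \<ge> N \<Longrightarrow> real_of_rat (a s) \<le> \<alpha>" using le by (auto simp: eventually_sequentially)
  obtain p q where pq: "computable p" "computable q" "\<And>s. q s \<noteq> 0 \<and> a s = of_nat (p s) / of_nat (q s)"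
    using a unfolding computable_approximation_def computable_nonneg_rat_seq_def by blast
  have less: "decidable_on 2 (\<lambda>xs. a (xs ! 0) < a (xs ! 1))"
    by (intro decidable_on_rat_less[OF pq] computable_on_nth) simp_all
  obtain m where "computable m \<and> m 0 = N
      \<and> (\<forall>k. m (Suc k) = (if a (m k) < a (N + Suc k) then N + Suc k else m k))"
    using computable_running_index[of "\<lambda>i j. a i < a j" N, OF less] by (rule exE)
  then have m: "computable m" "m 0 = N"
    "\<And>k. m (Suc k) = (if a (m k) < a (N + Suc k) then N + Suc k else m k)"
    by simp_all
  have lower: "a (N + k) \<le> a (m k)" and ge: "N \<le> m k" for k by (induction k) (auto simp: m(2,3))
  have "(\<lambda>s. real_of_rat (a (s + N))) \<longlonglongrightarrow> \<alpha>"
    using a by (intro LIMSEQ_ignore_initial_segment) (simp add: computable_approximation_def approximation_def)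
  moreover have "real_of_rat (a (s + N)) \<le> real_of_rat (a (m s))" for s
    using lower[of s] by (simp add: of_rat_less_eq add.commute)
  ultimately have "(\<lambda>s. real_of_rat (a (m s))) \<longlonglongrightarrow> \<alpha>"
    by (rule tendsto_sandwich[OF always_eventually[OF allI] always_eventually[OF allI[OF N[OF ge]]]
      _ tendsto_const, rotated])
  then have "computable_approximation \<alpha> (\<lambda>s. a (m s))" by (rule computable_approximation_subseq[OF a m(1)])
  moreover have "incseq (\<lambda>s. a (m s))" by (rule incseq_SucI) (simp add: m(3))
  ultimately show ?thesis unfolding left_ce_def left_ce_approximation_def by blast
qed

lemma right_ce_if_eventually_ge:
  assumes a: "computable_approximation \<alpha> a"
    and ge: "eventually (\<lambda>s. \<alpha> \<le> real_of_rat (a s)) sequentially"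
  shows "right_ce \<alpha>"
proof -
  obtain N where N: "\<And>s. s \<ge> N \<Longrightarrow> \<alpha> \<le> real_of_rat (a s)" using ge by (auto simp: eventually_sequentially)
  obtain p q where pq: "computable p" "computable q" "\<And>s. q s \<noteq> 0 \<and> a s = of_nat (p s) / of_nat (q s)"
    using a unfolding computable_approximation_def computable_nonneg_rat_seq_def by blast
  have less: "decidable_on 2 (\<lambda>xs. a (xs ! 1) < a (xs ! 0))"
    by (intro decidable_on_rat_less[OF pq] computable_on_nth) simp_all
  obtain m where "computable m \<and> m 0 = N
      \<and> (\<forall>k. m (Suc k) = (if a (N + Suc k) < a (m k) then N + Suc k else m k))"
    using computable_running_index[of "\<lambda>i j. a j < a i" N, OF less] by (rule exE)
  then have m: "computable m" "m 0 = N"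
    "\<And>k. m (Suc k) = (if a (N + Suc k) < a (m k) then N + Suc k else m k)"
    by simp_all
  have upper: "a (m k) \<le> a (N + k)" and ge: "N \<le> m k" for k by (induction k) (auto simp: m(2,3))
  have "(\<lambda>s. real_of_rat (a (s + N))) \<longlonglongrightarrow> \<alpha>"
    using a by (intro LIMSEQ_ignore_initial_segment) (simp add: computable_approximation_def approximation_def)
  moreover have "real_of_rat (a (m s)) \<le> real_of_rat (a (s + N))" for s
    using upper[of s] by (simp add: of_rat_less_eq add.commute)
  ultimately have "(\<lambda>s. real_of_rat (a (m s))) \<longlonglongrightarrow> \<alpha>"
    by (rule tendsto_sandwich[OF always_eventually[OF allI[OF N[OF ge]]] always_eventually[OF allI]
      tendsto_const, rotated])
  then have "computable_approximation \<alpha> (\<lambda>s. a (m s))" by (rule computable_approximation_subseq[OF a m(1)])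
  moreover have "decseq (\<lambda>s. a (m s))" by (rule decseq_SucI) (simp add: m(3))
  ultimately show ?thesis unfolding right_ce_def right_ce_approximation_def by blast
qed

text \<open>Without a crossing after \<open>m\<close>, one negative value there would make all later
  values negative.\<close>

lemma ex_sign_change:
  fixes e :: "nat \<Rightarrow> real"
  assumes nonzero: "\<And>s. e s \<noteq> 0"
    and pos: "\<exists>\<^sub>F s in sequentially. e s > 0" and neg: "\<exists>\<^sub>F s in sequentially. e s < 0"
  shows "\<exists>k\<ge>m. e k * e (Suc k) < 0"
proof (rule ccontr)
  assume no: "\<not> (\<exists>k\<ge>m. e k * e (Suc k) < 0)"
  obtain s where s: "s \<ge> m" "e s < 0" using neg by (auto simp: frequently_sequentially)
  obtain t where t: "t \<ge> s" "e t > 0" using pos by (auto simp: frequently_sequentially)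
  from t(1) have "e t < 0"
  proof (induction t rule: dec_induct)
    case (step k)
    then have "\<not> e k * e (Suc k) < 0" using no s(1) by auto
    then show ?case using step nonzero[of "Suc k"] by (auto simp: mult_less_0_iff)
  qed (rule s(2))
  then show False using t(2) by simp
qed

lemma speedable_if_not_ce:
  assumes a: "computable_approximation \<alpha> a" and "\<not> left_ce \<alpha>" "\<not> right_ce \<alpha>"
  shows "speedable \<alpha> a"
proof (cases "\<alpha> \<in> \<rat>")
  case True
  then show ?thesis by (auto simp: speedable_def rho_speedable_def intro!: exI[of _ 0])
next
  case irr: False
  show ?thesis
  proof (rule ccontr)
    assume not_speedable: "\<not> speedable \<alpha> a"
    obtain p q where p: "computable p" and q: "computable q"
      and pq: "\<And>s. q s \<noteq> 0" "\<And>s. a s = of_nat (p s) / of_nat (q s)"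
      using a unfolding computable_approximation_def computable_nonneg_rat_seq_def by blast
    define e where "e s = real_of_rat (a s) - \<alpha>" for s
    have e_pq: "e s = real (p s) / real (q s) - \<alpha>" for s
      by (simp add: e_def pq(2) of_rat_divide)
    have lim: "e \<longlonglongrightarrow> 0"
      unfolding e_def using a LIM_zero
      by (fastforce simp: computable_approximation_def approximation_def)
    have nonzero: "e s \<noteq> 0" for s
      using irr Rats_of_rat[of "a s"] by (auto simp: e_def)
    \<comment> \<open>The ratio 9/10 fails for every computable order, and a limit inferior above
      9/10 bounds the quotients eventually.\<close>
    have slow_order: "eventually (\<lambda>s. \<bar>e (h s)\<bar> > 9/10 * \<bar>e s\<bar>) sequentially" if "computable_order h" for h
    proof -
      have "\<not> rho_speedable (9/10) \<alpha> a"
        using not_speedable by (auto simp: speedable_def)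
      then have "ereal (9/10) < liminf (\<lambda>s. ereal \<bar>(\<alpha> - real_of_rat (a (h s))) / (\<alpha> - real_of_rat (a s))\<bar>)"
        using that irr by (auto simp: rho_speedable_def of_rat_divide not_le)
      then have "eventually (\<lambda>s. ereal (9/10) < ereal \<bar>(\<alpha> - real_of_rat (a (h s))) / (\<alpha> - real_of_rat (a s))\<bar>) sequentially"
        by (rule less_LiminfD)
      then show ?thesis
      proof eventually_elim
        case (elim s)
        have eq: "\<bar>(\<alpha> - real_of_rat (a (h s))) / (\<alpha> - real_of_rat (a s))\<bar> = \<bar>e (h s)\<bar> / \<bar>e s\<bar>"
          by (simp add: e_def abs_divide abs_minus_commute)
        have "9/10 < \<bar>e (h s)\<bar> / \<bar>e s\<bar>" using elim unfolding eq by simp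
        then show ?case using nonzero[of s] by (simp add: pos_less_divide_eq)
      qed
    qed
    \<comment> \<open>Applied to \<open>Suc\<close>, this keeps \<open>\<alpha>\<close> out of every
      interval recorded from \<open>n\<close> on.\<close>
    have "computable_order Suc"
      by (auto simp: computable_order_def computable_iff_computable_on mono_def
        intro!: computable_on_Suc computable_on_nth intro: le_SucI)
    then obtain n where n: "\<And>s. s \<ge> n \<Longrightarrow> \<bar>e (Suc s)\<bar> > 9/10 * \<bar>e s\<bar>"
      using slow_order by (fastforce simp: eventually_sequentially)
    \<comment> \<open>If \<open>e\<close> were eventually at most 0, \<open>\<alpha>\<close> would
      be left-c.e.; the other sign is treated symmetrically.\<close>
    have "\<exists>\<^sub>F s in sequentially. e s > 0"
      using left_ce_if_eventually_le[OF a] assms(2) by (auto simp: frequently_def e_def not_less)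
    moreover have "\<exists>\<^sub>F s in sequentially. e s < 0"
      using right_ce_if_eventually_ge[OF a] assms(3) by (auto simp: frequently_def e_def not_less)
    ultimately interpret crossing e n
      using lim nonzero n ex_sign_change[OF nonzero] by unfold_locales auto
    have progress: "decidable_on k (\<lambda>xs. progress e (U xs) (I xs))"
      if "computable_on k U" "computable_on k I" for k U I
      by (rule decidable_on_progress[OF p q pq(1) e_pq that])
    have b: "computable b" by (rule computable_last_barrier[OF progress])
    show False
      by (intro not_eventually_slow slow_order computable_order_f computable_order_g b progress)
  qed
qed

theorem corollary2p6:
  fixes \<alpha> :: real
  assumes "0 < \<alpha>" and "\<alpha> < 1"
    and "dce \<alpha>"
    and "\<not> left_ce \<alpha>" and "\<not> right_ce \<alpha>"
  shows "fully_dce_speedable \<alpha>"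
  unfolding fully_dce_speedable_def dce_approximation_def
  using assms(3) speedable_if_not_ce[OF _ assms(4,5)] by blast

end
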